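(* Let $n$ be an odd positive integer. The eigenvalues of $M_{\Phi_{2n}}^\dagger M_{\Phi_{2n}}$ are the same as the eigenvalues of $M_{\Phi_n}^\dagger M_{\Phi_n}$.
   Context: For a monic polynomial $f\in\mathbb{Z}[x]$ of degree $m$ with distinct complex roots $\alpha_1,\dots,\alpha_m$, $M_f$ denotes the $m\times m$ Vandermonde matrix with $(i,j)$ entry $\alpha_i^{\,j-1}$, and $M_f^\dagger$ its conjugate transpose. $\Phi_k$ is the $k$-th cyclotomic polynomial. *)

theory Defs
  imports
    "HOL-Computational_Algebra.Computational_Algebra"
    "Jordan_Normal_Form.Spectral_Radius"
    "Jordan_Normal_Form.Schur_Decomposition"
begin

definition primitive_roots_of_unity :: "nat \<Rightarrow> complex set" where
  "primitive_roots_of_unity k = {z. z ^ k = 1 \<and> (\<forall>j. 0 < j \<and> j < k \<longrightarrow> z ^ j \<noteq> 1)}"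

definition cyclotomic_complex :: "nat \<Rightarrow> complex poly" where
  "cyclotomic_complex k = (\<Prod>z\<in>primitive_roots_of_unity k. [:- z, 1:])"

text \<open>
  The cyclotomic polynomial as an element of \<open>\<int>[x]\<close>. The description is well-defined for
  \<open>k > 0\<close> by lemma \<open>of_int_poly_cyclotomic\<close> below.
\<close>
definition cyclotomic :: "nat \<Rightarrow> int poly" where
  "cyclotomic k = (THE f. map_poly of_int f = cyclotomic_complex k)"

definition root_list :: "int poly \<Rightarrow> complex list \<Rightarrow> bool" where
  "root_list f as \<longleftrightarrow>
     length as = degree f \<and> distinct as \<and> set as = {z. poly (map_poly of_int f) z = 0}"

text \<open>
  \<open>M\<^sub>f\<close> depends on the order in which the roots of \<open>f\<close> are listed, so it is
  \<open>vandermonde_mat as\<close> for some \<open>as\<close> with \<open>root_list f as\<close>. Indices start at 0, hence the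
  exponent \<open>j\<close> in place of \<open>j - 1\<close>.
\<close>
definition vandermonde_mat :: "complex list \<Rightarrow> complex mat" where
  "vandermonde_mat as = mat (length as) (length as) (\<lambda>(i, j). (as ! i) ^ j)"


lemma finite_primitive_roots_of_unity:
  assumes "k > 0" shows "finite (primitive_roots_of_unity k)"
  by (rule finite_subset[OF _ finite_roots_unity[of k]])
     (use assms in \<open>auto simp: primitive_roots_of_unity_def\<close>)

lemma roots_unity_eq_Union_primitive:
  assumes "n > 0"
  shows "{z :: complex. z ^ n = 1} = (\<Union>d\<in>{d. d dvd n}. primitive_roots_of_unity d)"
proof (intro equalityI subsetI)
  fix z :: complex assume "z \<in> {z. z ^ n = 1}"
  then have z: "z ^ n = 1" by simp
  define d where "d = (LEAST d. d > 0 \<and> z ^ d = 1)"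
  have d: "d > 0 \<and> z ^ d = 1"
    unfolding d_def by (rule LeastI[of _ n]) (use assms z in auto)
  have min: "z ^ j \<noteq> 1" if "0 < j" "j < d" for j
    using not_less_Least[of j "\<lambda>d. d > 0 \<and> z ^ d = 1"] that unfolding d_def by auto
  have "z ^ n = z ^ (d * (n div d) + n mod d)" by simp
  also have "\<dots> = z ^ (n mod d)"
    using d by (simp only: power_add power_mult) simp
  finally have "z ^ (n mod d) = 1" using z by simp
  with min[of "n mod d"] d have "n mod d = 0" by fastforce
  then have "d dvd n" by auto
  moreover have "z \<in> primitive_roots_of_unity d"
    using d min by (auto simp: primitive_roots_of_unity_def)
  ultimately show "z \<in> (\<Union>d\<in>{d. d dvd n}. primitive_roots_of_unity d)" by blast
next
  fix z :: complex assume "z \<in> (\<Union>d\<in>{d. d dvd n}. primitive_roots_of_unity d)"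
  then show "z \<in> {z. z ^ n = 1}"
    by (auto simp: primitive_roots_of_unity_def power_mult elim!: dvdE)
qed

lemma primitive_roots_of_unity_disjoint:
  assumes "0 < c" "0 < d" "c \<noteq> d"
  shows "primitive_roots_of_unity c \<inter> primitive_roots_of_unity d = {}"
proof (rule ccontr)
  assume "primitive_roots_of_unity c \<inter> primitive_roots_of_unity d \<noteq> {}"
  then obtain z where "z \<in> primitive_roots_of_unity c" "z \<in> primitive_roots_of_unity d" by blast
  then have "z ^ c = 1" "z ^ d = 1" "\<not> (0 < d \<and> d < c)" "\<not> (0 < c \<and> c < d)"
    unfolding primitive_roots_of_unity_def by auto
  then show False using assms by linarith
qed

lemma monic_prod_linear:
  fixes A :: "complex set"
  shows "monic (\<Prod>z\<in>A. [:- z, 1:])" "degree (\<Prod>z\<in>A. [:- z, 1:]) = card A"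
proof -
  show "monic (\<Prod>z\<in>A. [:- z, 1:])"
    by (rule monic_prod) simp
  show "degree (\<Prod>z\<in>A. [:- z, 1:]) = card A"
    by (subst degree_prod_eq_sum_degree) auto
qed

lemma X_pow_minus_1_eq_prod:
  assumes "n > 0"
  shows "monom 1 n - 1 = (\<Prod>z | z ^ n = 1. [:- z, 1 :: complex:])"
proof (rule poly_eqI_degree_lead_coeff[where n = n and A = "{z. z ^ n = 1}"])
  have fin: "finite {z :: complex. z ^ n = 1}" using finite_roots_unity[of n] assms by simp
  have card: "card {z :: complex. z ^ n = 1} = n" by (rule card_roots_unity_eq[OF assms])
  note m = monic_prod_linear[of "{z. z ^ n = 1}", unfolded card]
  show "coeff (monom 1 n - 1) n = coeff (\<Prod>z | z ^ n = 1. [:- z, 1 :: complex:]) n"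
    using m(1)[unfolded m(2)] assms by simp
  show "degree (\<Prod>z | z ^ n = 1. [:- z, 1 :: complex:]) \<le> n" by (simp only: m)
  show "n \<le> card {z :: complex. z ^ n = 1}" using card by simp
  show "degree (monom 1 n - 1 :: complex poly) \<le> n"
    by (intro degree_diff_le) (auto simp: degree_monom_le)
  show "poly (monom 1 n - 1) x = poly (\<Prod>z | z ^ n = 1. [:- z, 1:]) x"
    if "x \<in> {z. z ^ n = 1}" for x :: complex
    using that fin by (auto simp: poly_monom poly_prod)
qed

lemma X_pow_minus_1_eq_prod_cyclotomic:
  assumes "n > 0"
  shows "monom 1 n - 1 = (\<Prod>d | d dvd n. cyclotomic_complex d)"
proof -
  have "monom 1 n - 1 = (\<Prod>z\<in>(\<Union>d\<in>{d. d dvd n}. primitive_roots_of_unity d). [:- z, 1 :: complex:])"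
    by (simp add: X_pow_minus_1_eq_prod[OF assms] flip: roots_unity_eq_Union_primitive[OF assms])
  also have "\<dots> = (\<Prod>d | d dvd n. cyclotomic_complex d)"
    unfolding cyclotomic_complex_def
  proof (rule prod.UNION_disjoint)
    show "finite {d. d dvd n}" using assms by simp
    show "\<forall>d\<in>{d. d dvd n}. finite (primitive_roots_of_unity d)"
      using assms by (auto intro!: finite_primitive_roots_of_unity dest: dvd_pos_nat)
    show "\<forall>c\<in>{d. d dvd n}. \<forall>d\<in>{d. d dvd n}. c \<noteq> d \<longrightarrow>
        primitive_roots_of_unity c \<inter> primitive_roots_of_unity d = {}"
      by (intro ballI impI primitive_roots_of_unity_disjoint) (use assms in \<open>auto dest: dvd_pos_nat\<close>)
  qed
  finally show ?thesis .
qed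

lemma monic_cyclotomic_complex:
  "monic (cyclotomic_complex k)"
  unfolding cyclotomic_complex_def by (rule monic_prod_linear)

lemma cyclotomic_complex_integral:
  assumes "n > 0"
  shows "\<exists>f :: int poly. map_poly of_int f = cyclotomic_complex n"
  using assms
proof (induction n rule: less_induct)
  case (less n)
  let ?D = "{d. d dvd n \<and> d < n}"
  let ?h = "map_poly of_int :: int poly \<Rightarrow> complex poly"
  have D: "d > 0" "d < n" if "d \<in> ?D" for d using that less.prems by (auto dest: dvd_pos_nat)
  have "\<forall>d\<in>?D. \<exists>f. ?h f = cyclotomic_complex d" using less.IH D by blast
  then obtain F where F: "?h (F d) = cyclotomic_complex d" if "d \<in> ?D" for d by metis
  define q where "q = (\<Prod>d\<in>?D. F d)"
  have hq: "?h q = (\<Prod>d\<in>?D. cyclotomic_complex d)"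
    unfolding q_def by (simp add: of_int_poly_hom.hom_prod F)
  have mq: "monic q"
  proof -
    have "lead_coeff (?h q) = 1"
      unfolding hq lead_coeff_prod by (simp add: monic_cyclotomic_complex)
    then show ?thesis by simp
  qed
  have q0: "q \<noteq> 0" using mq by auto
  define f where "f = (monom 1 n - 1 :: int poly)"
  have hf: "?h f = ?h q * cyclotomic_complex n"
  proof -
    have "?h f = monom 1 n - 1" unfolding f_def by (simp add: hom_distribs)
    also have "\<dots> = (\<Prod>d\<in>insert n ?D. cyclotomic_complex d)"
      unfolding X_pow_minus_1_eq_prod_cyclotomic[OF less.prems]
      by (rule prod.cong) (use less.prems in \<open>auto dest: dvd_imp_le\<close>)
    also have "\<dots> = cyclotomic_complex n * ?h q" unfolding hq by (subst prod.insert) auto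
    finally show ?thesis by simp
  qed
  obtain s r where sr: "pseudo_divmod f q = (s, r)" by force
  from pseudo_divmod[OF q0 sr] mq
  have f: "f = q * s + r" and r: "r = 0 \<or> degree r < degree q" by auto
  have eq: "?h q * (cyclotomic_complex n - ?h s) = ?h r"
    using hf unfolding f by (simp add: hom_distribs algebra_simps)
  have "cyclotomic_complex n - ?h s = 0"
  proof (rule ccontr)
    assume n0: "cyclotomic_complex n - ?h s \<noteq> 0"
    have q0': "?h q \<noteq> 0" using q0 by simp
    have "?h r \<noteq> 0" using n0 q0' unfolding eq[symmetric] by simp
    then have "degree r < degree q" using r by auto
    moreover have "degree (?h r) = degree (?h q) + degree (cyclotomic_complex n - ?h s)"
      unfolding eq[symmetric] by (rule degree_mult_eq[OF q0' n0])
    ultimately show False by simp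
  qed
  then show ?case by (intro exI[of _ s]) simp
qed

lemma of_int_poly_cyclotomic:
  assumes "k > 0"
  shows "map_poly of_int (cyclotomic k) = cyclotomic_complex k"
proof -
  obtain f :: "int poly" where f: "map_poly of_int f = cyclotomic_complex k"
    using cyclotomic_complex_integral[OF assms] by blast
  show ?thesis unfolding cyclotomic_def
  proof (rule theI[of _ f])
    show "map_poly of_int f = cyclotomic_complex k" by (rule f)
    show "g = f" if "map_poly of_int g = cyclotomic_complex k" for g
      using that unfolding f[symmetric] by (rule of_int_poly_hom.injectivity)
  qed
qed

lemma roots_cyclotomic:
  assumes "k > 0"
  shows "{z. poly (map_poly of_int (cyclotomic k)) z = 0} = primitive_roots_of_unity k"
  using finite_primitive_roots_of_unity[OF assms]
  by (auto simp: of_int_poly_cyclotomic[OF assms] cyclotomic_complex_def poly_prod)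

lemma root_list_cyclotomic_exists:
  assumes "k > 0"
  shows "\<exists>as. root_list (cyclotomic k) as"
proof -
  note fin = finite_primitive_roots_of_unity[OF assms]
  obtain as where as: "set as = primitive_roots_of_unity k" "distinct as"
    using finite_distinct_list[OF fin] by blast
  have "degree (cyclotomic k) = degree (map_poly of_int (cyclotomic k) :: complex poly)" by simp
  also have "\<dots> = card (primitive_roots_of_unity k)"
    unfolding of_int_poly_cyclotomic[OF assms] cyclotomic_complex_def by (rule monic_prod_linear)
  finally show ?thesis
    using as roots_cyclotomic[OF assms] distinct_card[OF as(2)] unfolding root_list_def by metis
qed

end

(* For odd n the primitive 2n-th roots of unity are the negatives of the primitive n-th ones.
   The (j,k) entry of the Gram matrix is the sum of cnj z ^ j * z ^ k over the roots z, so
   passing from n to 2n multiplies it by (-1)^(j+k), which is conjugation by the diagonal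
   matrix of alternating signs. *)
theory Submission
  imports Defs
begin

text \<open>Division with remainder: \<open>z ^ (j mod n)\<close> is again 1, and the minimality of
  \<open>n\<close> among positive exponents forces the remainder to vanish.\<close>

lemma primitive_roots_of_unity_dvd:
  assumes "z \<in> primitive_roots_of_unity n" "n > 0" "z ^ j = 1"
  shows "n dvd j"
proof -
  have "z ^ j = z ^ (n * (j div n) + j mod n)" by simp
  also have "\<dots> = z ^ (j mod n)"
    using assms by (simp only: power_add power_mult) (simp add: primitive_roots_of_unity_def)
  finally have "z ^ (j mod n) = 1" using assms by simp
  moreover have "j mod n < n" using assms by simp
  ultimately have "\<not> 0 < j mod n" using assms(1) by (auto simp: primitive_roots_of_unity_def)
  then show ?thesis by auto
qed

text \<open>If \<open>w\<close> is a primitive \<open>2 * n\<close>-th root, then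
  \<open>w ^ n\<close> is a square root of 1 other than 1, so it is \<open>- 1\<close>, and oddness
  of \<open>n\<close> gives \<open>(- w) ^ n = 1\<close>. Conversely, any exponent that sends
  \<open>- z\<close> to 1 is divisible by the coprime numbers 2 and \<open>n\<close>.\<close>

lemma primitive_roots_of_unity_double_odd:
  assumes "odd n"
  shows "primitive_roots_of_unity (2 * n) = uminus ` primitive_roots_of_unity n"
proof (intro equalityI subsetI)
  have n: "n > 0" using assms by (rule odd_pos)
  fix w assume w: "w \<in> primitive_roots_of_unity (2 * n)"
  have "(w ^ n)\<^sup>2 = 1"
    using w by (simp add: primitive_roots_of_unity_def mult.commute flip: power_mult)
  moreover have "w ^ n \<noteq> 1" using w n unfolding primitive_roots_of_unity_def by auto
  ultimately have "w ^ n = - 1" by (simp add: power2_eq_1_iff)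
  then have "(- w) ^ n = 1" using assms by simp
  moreover have "(- w) ^ j \<noteq> 1" if "0 < j" "j < n" for j
  proof
    assume "(- w) ^ j = 1"
    \<comment> \<open>Squaring removes the sign, and \<open>2 * j < 2 * n\<close> contradicts the
      primitivity of \<open>w\<close>.\<close>
    then have "((- w) ^ j)\<^sup>2 = 1" by simp
    then have "w ^ (2 * j) = 1" by (simp add: mult.commute flip: power_mult)
    then show False using w that unfolding primitive_roots_of_unity_def by auto
  qed
  ultimately have "- w \<in> primitive_roots_of_unity n"
    by (simp add: primitive_roots_of_unity_def)
  then show "w \<in> uminus ` primitive_roots_of_unity n" by force
next
  have n: "n > 0" using assms by (rule odd_pos)
  fix w assume "w \<in> uminus ` primitive_roots_of_unity n"
  then obtain z where z: "z \<in> primitive_roots_of_unity n" and w: "w = - z" by blast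
  have "z ^ n = 1" using z by (simp add: primitive_roots_of_unity_def)
  then have "z ^ (2 * n) = 1" by (simp add: power_even_eq)
  then have "w ^ (2 * n) = 1" by (simp add: w)
  moreover have "w ^ j \<noteq> 1" if "0 < j" "j < 2 * n" for j
  proof
    assume wj: "w ^ j = 1"
    \<comment> \<open>The even exponent passes the information from \<open>w\<close> to
      \<open>z\<close>; the factor 2 is cancelled afterwards because \<open>n\<close> is
      odd.\<close>
    then have "w ^ (2 * j) = 1" by (simp add: power_even_eq)
    then have "z ^ (2 * j) = 1" by (simp add: w)
    then have "n dvd 2 * j" using primitive_roots_of_unity_dvd z n by blast
    then have nj: "n dvd j" using assms by (simp add: coprime_dvd_mult_right_iff)
    with \<open>z ^ n = 1\<close> have "z ^ j = 1" by (metis dvdE power_mult power_one)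
    \<comment> \<open>For odd \<open>j\<close> the sign would survive:
      \<open>w ^ j = - (z ^ j) = - 1\<close>.\<close>
    with wj have "even j" by (metis power_minus_odd w neg_eq_iff_add_eq_0 one_add_one zero_neq_numeral)
    moreover have "coprime 2 n" using assms by simp
    ultimately have "2 * n dvd j" using nj by (intro divides_mult)
    with that show False by (auto dest: dvd_imp_le)
  qed
  ultimately show "w \<in> primitive_roots_of_unity (2 * n)"
    by (simp add: primitive_roots_of_unity_def)
qed

text \<open>The row index of the Vandermonde matrix is summed away, and distinctness makes indexing
  a bijection onto \<open>set as\<close>. Hence the Gram matrix does not depend on the order in
  which the roots are listed.\<close>

lemma gram_vandermonde_mat:
  assumes "distinct as"
  shows "mat_adjoint (vandermonde_mat as) * vandermonde_mat as =
    mat (length as) (length as) (\<lambda>(j, k). \<Sum>z\<in>set as. cnj z ^ j * z ^ k)"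
proof (rule eq_matI)
  fix j k
  assume "j < dim_row (mat (length as) (length as) (\<lambda>(j, k). \<Sum>z\<in>set as. cnj z ^ j * z ^ k))"
    and "k < dim_col (mat (length as) (length as) (\<lambda>(j, k). \<Sum>z\<in>set as. cnj z ^ j * z ^ k))"
  then have jk: "j < length as" "k < length as" by simp_all
  have "(mat_adjoint (vandermonde_mat as) * vandermonde_mat as) $$ (j, k) =
      (\<Sum>i<length as. cnj (as ! i) ^ j * (as ! i) ^ k)"
    using jk by (auto simp: vandermonde_mat_def mat_adjoint_def mat_of_rows_def scalar_prod_def
        atLeast0LessThan conjugate_complex_def intro!: sum.cong)
  also have "\<dots> = (\<Sum>z\<in>set as. cnj z ^ j * z ^ k)"
    using sum.reindex_bij_betw[OF bij_betw_nth[OF assms refl refl],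
        of "\<lambda>z. cnj z ^ j * z ^ k"] by simp
  finally show "(mat_adjoint (vandermonde_mat as) * vandermonde_mat as) $$ (j, k) =
      mat (length as) (length as) (\<lambda>(j, k). \<Sum>z\<in>set as. cnj z ^ j * z ^ k) $$ (j, k)"
    using jk by simp
qed (simp_all add: vandermonde_mat_def mat_adjoint_def)

text \<open>The sign splits into \<open>(- 1) ^ j\<close> scaling row \<open>j\<close> and
  \<open>(- 1) ^ k\<close> scaling column \<open>k\<close>. Both scalings come from the same
  diagonal matrix, which is its own inverse, so together they are a conjugation.\<close>

lemma similar_mat_alternating_signs:
  fixes f :: "nat \<Rightarrow> nat \<Rightarrow> 'a :: comm_ring_1"
  shows "similar_mat (mat m m (\<lambda>(j, k). (- 1) ^ (j + k) * f j k)) (mat m m (\<lambda>(j, k). f j k))"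
proof -
  define D :: "'a mat" where "D = mat_diag m (\<lambda>i. (- 1) ^ i)"
  have D: "D \<in> carrier_mat m m" by (simp add: D_def mat_diag_def)
  have "D * D = mat_diag m (\<lambda>i. (- 1) ^ i * (- 1) ^ i)"
    unfolding D_def by (simp add: mat_diag_diag)
  also have "\<dots> = 1\<^sub>m m" by (simp add: flip: power_mult_distrib)
  finally have DD: "D * D = 1\<^sub>m m" .
  have "mat m m (\<lambda>(j, k). (- 1) ^ (j + k) * f j k) = D * mat m m (\<lambda>(j, k). f j k) * D"
    unfolding D_def
    by (subst mat_diag_mult_left[of _ _ m], simp, subst mat_diag_mult_right[of _ m])
       (auto simp: power_add mult_ac)
  then have "similar_mat_wit (mat m m (\<lambda>(j, k). (- 1) ^ (j + k) * f j k))
      (mat m m (\<lambda>(j, k). f j k)) D D"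
    using D DD by (intro similar_mat_witI) auto
  then show ?thesis unfolding similar_mat_def by blast
qed

text \<open>Equality of eigenvalues is taken both as sets and with algebraic multiplicity, the
  latter being the order of \<open>x\<close> as a root of the characteristic polynomial. Both
  listings of roots are arbitrary.\<close>

theorem theorem4:
  fixes n :: nat and as bs :: "complex list"
  assumes "odd n"
    and "root_list (cyclotomic n) as"
    and "root_list (cyclotomic (2 * n)) bs"
  shows "let A = mat_adjoint (vandermonde_mat as) * vandermonde_mat as;
             B = mat_adjoint (vandermonde_mat bs) * vandermonde_mat bs
         in spectrum B = spectrum A \<and>
            (\<forall>x. order x (char_poly B) = order x (char_poly A))"
proof -
  have n: "n > 0" using assms(1) by (rule odd_pos)
  define A where "A = mat_adjoint (vandermonde_mat as) * vandermonde_mat as"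
  define B where "B = mat_adjoint (vandermonde_mat bs) * vandermonde_mat bs"
  have as: "distinct as" "set as = primitive_roots_of_unity n"
    using assms(2) roots_cyclotomic[OF n] by (simp_all add: root_list_def)
  have bs: "distinct bs" "set bs = uminus ` set as"
    using assms(3) roots_cyclotomic[of "2 * n"] n
    by (simp_all add: root_list_def as primitive_roots_of_unity_double_odd[OF assms(1)])
  \<comment> \<open>Negation is injective, so the two Gram matrices have the same size.\<close>
  have len: "length bs = length as"
    using bs as(1) by (simp add: card_image flip: distinct_card)
  have "(\<Sum>z\<in>set bs. cnj z ^ j * z ^ k) =
      (- 1) ^ (j + k) * (\<Sum>z\<in>set as. cnj z ^ j * z ^ k)" for j k
  proof -
    have "cnj (- z) ^ j * (- z) ^ k = (- 1) ^ (j + k) * (cnj z ^ j * z ^ k)" for z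
      using power_minus[of "cnj z" j] power_minus[of z k] by (simp add: power_add)
    then show ?thesis
      by (simp add: bs sum.reindex sum_distrib_left)
  qed
  then have "similar_mat B A"
    unfolding A_def B_def gram_vandermonde_mat[OF as(1)] gram_vandermonde_mat[OF bs(1)] len
    by (simp only: similar_mat_alternating_signs)
  then have char_poly: "char_poly B = char_poly A" by (rule char_poly_similar)
  have "A \<in> carrier_mat (length as) (length as)" "B \<in> carrier_mat (length as) (length as)"
    unfolding A_def B_def gram_vandermonde_mat[OF as(1)] gram_vandermonde_mat[OF bs(1)] len
    by simp_all
  \<comment> \<open>The eigenvalues of a square matrix are the roots of its characteristic
    polynomial.\<close>
  then have "spectrum B = spectrum A"
    using char_poly by (auto simp: spectrum_def eigenvalue_root_char_poly)
  with char_poly show ?thesis unfolding A_def B_def by simp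
qed

end
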